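(* Let $\phi:\mathbb{R}^{n-1}\to[0,+\infty)$ be a convex function such that the set $\{\phi=0\}$ is nonempty and compact. Given numbers $\epsilon>0$ and $R>0$, there is a smooth convex function $\psi:\mathbb{R}^{n-1}\to\mathbb{R}$ such that $\psi<\phi$ on $\mathbb{R}^{n-1}$, $\phi(x)-\psi(x)<\epsilon$ for all $|x|\le R$, and the epigraph $E_\psi=\{(x,y)\in\mathbb{R}^{n-1}\times\mathbb{R}: y\ge\psi(x)\}$ has bounded convex exhaustion hulls (BCEH).
   Context: A closed convex set $E\subset\mathbb{R}^n$ has bounded convex exhaustion hulls (BCEH) if for every compact convex set $K\subset\mathbb{R}^n$ the set $h(E,K)=\mathrm{Conv}(E\cup K)\setminus E$ is bounded, where $\mathrm{Conv}$ denotes the convex hull. *)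

theory Defs
  imports "HOL-Analysis.Analysis"
begin

text \<open>\<open>C_k k f\<close> says that \<open>f\<close> is \<open>k\<close> times continuously differentiable on the whole space:
  the (Frechet) derivative exists everywhere, and each directional derivative is of class
  \<open>C_k\<close> again. In finite dimension this is the usual condition that all
  partial derivatives of order at most \<open>k\<close> exist and are continuous.\<close>

primrec C_k :: "nat \<Rightarrow> ('a::euclidean_space \<Rightarrow> real) \<Rightarrow> bool" where
  "C_k 0 f \<longleftrightarrow> continuous_on UNIV f"
| "C_k (Suc k) f \<longleftrightarrow>
     (\<forall>x. f differentiable (at x)) \<and>
     (\<forall>v. C_k k (\<lambda>x. frechet_derivative f (at x) v))"

definition smooth :: "('a::euclidean_space \<Rightarrow> real) \<Rightarrow> bool" where
  "smooth f \<longleftrightarrow> (\<forall>k. C_k k f)"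

definition exhaustion_hull :: "'a::euclidean_space set \<Rightarrow> 'a set \<Rightarrow> 'a set" where
  "exhaustion_hull E K = convex hull (E \<union> K) - E"

text \<open>Bounded convex exhaustion hulls are only defined for closed convex sets, so closedness and
  convexity are part of the predicate.\<close>

definition BCEH :: "'a::euclidean_space set \<Rightarrow> bool" where
  "BCEH E \<longleftrightarrow> closed E \<and> convex E \<and>
     (\<forall>K. compact K \<and> convex K \<longrightarrow> bounded (exhaustion_hull E K))"

end

theory Submission
  imports Defs
begin

text \<open>
  An epigraph has bounded convex exhaustion hulls as soon as its tangent planes sink to \<open>-\<infinity>\<close>,
  locally uniformly, when the point of tangency goes to infinity: a compact set then lies above all
  tangent planes at far away points, and adding it to the epigraph changes nothing over these points
  (\<open>BCEH_epigraph_if_tangents_sink\<close>). A cone does not have this property, but the function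
  \<open>s - ln s\<close> with \<open>s = sqrt (1 + |x|\<^sup>2)\<close> does: it is smooth, convex and of linear growth, yet its
  tangent planes sink logarithmically (\<open>log_bent_norm_tangent_le\<close>).

  The property is inherited by \<open>f + a * (s - ln s)\<close> for every differentiable convex \<open>f\<close> and every
  \<open>a > 0\<close>, since the tangent planes of \<open>f\<close> are bounded above on bounded sets by \<open>f\<close> itself
  (\<open>BCEH_epigraph_add_log_bent_norm\<close>). So it remains to approximate \<open>\<phi>\<close> from below by a
  smooth convex \<open>L\<close> and to find a function \<open>h < \<phi>\<close> of the form \<open>a * (s - ln s) - c\<close>; then
  \<open>\<psi> = (1 - \<delta>) * L + \<delta> * h\<close> with a small \<open>\<delta> > 0\<close> is as required.

  For \<open>L\<close>, finitely many affine minorants of \<open>\<phi>\<close> have a maximum close to \<open>\<phi>\<close> on the ball of radius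
  \<open>R\<close> (\<open>convex_on_finite_affine_minorants\<close>), and the logarithm of a sum of exponentials turns this
  maximum into a smooth convex function. The function \<open>h\<close> exists because \<open>\<phi>\<close> grows at least linearly,
  and this is where compactness of the zero set enters (\<open>convex_on_linear_growth\<close>).
\<close>

section \<open>Smoothness is preserved by arithmetic and elementary functions\<close>

lemma C_k_SucI:
  assumes "\<And>x. (f has_derivative f' x) (at x)"
    and "\<And>v. C_k k (\<lambda>x. f' x v)"
  shows "C_k (Suc k) f"
proof -
  have "frechet_derivative f (at x) = f' x" for x
    using frechet_derivative_at[OF assms(1)] by metis
  then show ?thesis
    using assms by (auto simp: differentiable_def)
qed

lemma C_k_SucD:
  assumes "C_k (Suc k) f"
  shows "(f has_derivative frechet_derivative f (at x)) (at x)"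
    and "C_k k (\<lambda>x. frechet_derivative f (at x) v)"
  using assms frechet_derivative_works by auto

lemma C_k_Suc_imp: "C_k (Suc k) f \<Longrightarrow> C_k k f"
proof (induction k arbitrary: f)
  case 0
  then show ?case
    by (simp add: differentiable_imp_continuous_on differentiable_on_def)
next
  case (Suc k)
  then show ?case
    by (metis C_k.simps(2))
qed

lemma C_k_const: "C_k k (\<lambda>x. c)"
proof (induction k arbitrary: c)
  case (Suc k)
  show ?case
    by (rule C_k_SucI[of _ "\<lambda>x v. 0"]) (use Suc in auto)
qed simp

lemma C_k_bounded_linear:
  assumes "bounded_linear f"
  shows "C_k k f"
proof (cases k)
  case 0
  then show ?thesis
    using assms linear_continuous_on by auto
next
  case (Suc j)
  have "C_k (Suc j) f"
    by (rule C_k_SucI[of _ "\<lambda>x. f"])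
      (use assms bounded_linear_imp_has_derivative C_k_const in auto)
  then show ?thesis
    using Suc by simp
qed

lemma C_k_add: "C_k k f \<Longrightarrow> C_k k g \<Longrightarrow> C_k k (\<lambda>x. f x + g x)"
proof (induction k arbitrary: f g)
  case 0
  then show ?case
    by (simp add: continuous_on_add)
next
  case (Suc k)
  show ?case
    by (rule C_k_SucI[OF has_derivative_add[OF Suc.prems[THEN C_k_SucD(1)]]])
      (intro Suc.IH Suc.prems[THEN C_k_SucD(2)])
qed

lemma C_k_mult: "C_k k f \<Longrightarrow> C_k k g \<Longrightarrow> C_k k (\<lambda>x. f x * g x)"
proof (induction k arbitrary: f g)
  case 0
  then show ?case
    by (simp add: continuous_on_mult)
next
  case (Suc k)
  show ?case
    by (rule C_k_SucI[OF has_derivative_mult[OF Suc.prems[THEN C_k_SucD(1)]]])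
      (intro C_k_add Suc.IH Suc.prems[THEN C_k_Suc_imp] Suc.prems[THEN C_k_SucD(2)])
qed

lemma C_k_sum: "(\<And>i. i \<in> I \<Longrightarrow> C_k k (f i)) \<Longrightarrow> C_k k (\<lambda>x. \<Sum>i\<in>I. f i x)"
  by (induction I rule: infinite_finite_induct) (auto intro: C_k_const C_k_add)

text \<open>
  For each elementary function \<open>g\<close> below, the derivative of \<open>g \<circ> f\<close> in a direction is the
  derivative of \<open>f\<close> times an expression in \<open>g \<circ> f\<close> and reciprocals. One differentiation thus
  leads back to the same compositions at a lower order, without formulas for higher derivatives.
\<close>

lemma C_k_exp: "C_k k f \<Longrightarrow> C_k k (\<lambda>x. exp (f x))"
proof (induction k arbitrary: f)
  case 0
  then show ?case
    by (simp add: continuous_on_exp)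
next
  case (Suc k)
  have "((\<lambda>x. exp (f x)) has_derivative (\<lambda>v. exp (f x) * frechet_derivative f (at x) v)) (at x)" for x
    by (rule derivative_eq_intros C_k_SucD(1)[OF Suc.prems] refl | simp add: mult.commute)+
  then show ?case
    by (rule C_k_SucI) (intro C_k_mult Suc.IH C_k_Suc_imp[OF Suc.prems] C_k_SucD(2)[OF Suc.prems])
qed

lemma C_k_inverse:
  assumes "\<And>x. f x > 0"
  shows "C_k k f \<Longrightarrow> C_k k (\<lambda>x. inverse (f x))"
proof (induction k)
  case 0
  then show ?case
    using assms by (auto intro!: continuous_on_inverse simp: less_le)
next
  case (Suc k)
  have "f x \<noteq> 0" for x
    using assms[of x] by simp
  then have "((\<lambda>x. inverse (f x)) has_derivative
      (\<lambda>v. (-1 * (inverse (f x) * inverse (f x))) * frechet_derivative f (at x) v)) (at x)" for x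
    by - (rule derivative_eq_intros C_k_SucD(1)[OF Suc.prems] refl | simp add: ac_simps)+
  then show ?case
    by (rule C_k_SucI) (intro C_k_mult Suc.IH C_k_const C_k_Suc_imp[OF Suc.prems] C_k_SucD(2)[OF Suc.prems])
qed

lemma C_k_ln:
  assumes "\<And>x. f x > 0" and "C_k k f"
  shows "C_k k (\<lambda>x. ln (f x))"
proof (cases k)
  case 0
  then show ?thesis
    using assms by (auto intro!: continuous_on_ln simp: less_le)
next
  case (Suc j)
  then have f: "C_k (Suc j) f"
    using assms by simp
  have "((\<lambda>x. ln (f x)) has_derivative (\<lambda>v. inverse (f x) * frechet_derivative f (at x) v)) (at x)" for x
    using assms(1)[of x]
    by - (rule derivative_eq_intros C_k_SucD(1)[OF f] refl | simp add: field_simps)+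
  then have "C_k (Suc j) (\<lambda>x. ln (f x))"
    by (rule C_k_SucI) (intro C_k_mult C_k_inverse assms(1) C_k_Suc_imp[OF f] C_k_SucD(2)[OF f])
  then show ?thesis
    using Suc by simp
qed

lemma C_k_sqrt:
  assumes "\<And>x. f x > 0"
  shows "C_k k f \<Longrightarrow> C_k k (\<lambda>x. sqrt (f x))"
proof (induction k)
  case 0
  then show ?case
    by (simp add: continuous_on_real_sqrt)
next
  case (Suc k)
  have "((\<lambda>x. sqrt (f x)) has_derivative
      (\<lambda>v. (1/2 * inverse (sqrt (f x))) * frechet_derivative f (at x) v)) (at x)" for x
    using assms[of x]
    by - (rule derivative_eq_intros C_k_SucD(1)[OF Suc.prems] refl | simp add: field_simps)+
  then show ?case
    by (rule C_k_SucI)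
      (intro C_k_mult Suc.IH C_k_const C_k_inverse C_k_Suc_imp[OF Suc.prems] C_k_SucD(2)[OF Suc.prems], use assms in auto)
qed

section \<open>Tangent planes of convex functions\<close>

lemma convex_on_above_tangent:
  fixes f :: "'a::real_normed_vector \<Rightarrow> real"
  assumes f: "convex_on UNIV f" and D: "(f has_derivative D) (at x)"
  shows "f x + D (z - x) \<le> f z"
proof -
  define g where "g = (\<lambda>t::real. f (x + t *\<^sub>R (z - x)))"
  have "convex_on UNIV g"
  proof (rule convex_onI)
    fix t a b :: real
    assume t: "0 < t" "t < 1"
    have "x + ((1 - t) *\<^sub>R a + t *\<^sub>R b) *\<^sub>R (z - x) =
        (1 - t) *\<^sub>R (x + a *\<^sub>R (z - x)) + t *\<^sub>R (x + b *\<^sub>R (z - x))"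
      by (simp add: algebra_simps)
    then show "g ((1 - t) *\<^sub>R a + t *\<^sub>R b) \<le> (1 - t) * g a + t * g b"
      unfolding g_def using convex_onD[OF f, of t] t by simp
  qed simp
  moreover have "(g has_field_derivative D (z - x)) (at 0)"
  proof -
    have lin: "((\<lambda>t::real. x + t *\<^sub>R (z - x)) has_derivative (\<lambda>t. t *\<^sub>R (z - x))) (at 0)"
      by (auto intro!: derivative_eq_intros)
    have "(f has_derivative D) (at (x + 0 *\<^sub>R (z - x)))"
      using D by simp
    from has_derivative_compose[OF lin this] have "(g has_derivative (\<lambda>t. D (t *\<^sub>R (z - x)))) (at 0)"
      by (simp add: g_def)
    then show ?thesis
      using linear_scale[OF has_derivative_linear[OF D]]
      by (simp add: has_field_derivative_def mult.commute[of _ "D (z - x)"])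
  qed
  ultimately have "D (z - x) * (1 - 0) \<le> g 1 - g 0"
    by (intro convex_on_imp_above_tangent[where A = UNIV]) auto
  then show ?thesis
    by (simp add: g_def)
qed

text \<open>
  Strictly separating the point \<open>(x, f x - \<eta>)\<close> from the closed convex epigraph gives a hyperplane
  that is not vertical, because \<open>(x, f x)\<close> lies above that point on the same vertical line.
\<close>

lemma convex_on_affine_minorant:
  fixes f :: "'a::euclidean_space \<Rightarrow> real"
  assumes f: "convex_on UNIV f" and "\<eta> > 0"
  shows "\<exists>p c. (\<forall>z. p \<bullet> z + c \<le> f z) \<and> f x - \<eta> < p \<bullet> x + c"
proof -
  have cont: "continuous_on UNIV f"
    using convex_on_continuous[OF open_UNIV f] .
  have "closed (epigraph UNIV f)"
    unfolding epigraph_def using cont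
    by (auto intro!: closed_Collect_le continuous_intros continuous_on_compose2[OF cont])
  moreover have "(x, f x - \<eta>) \<notin> epigraph UNIV f"
    using \<open>\<eta> > 0\<close> by (simp add: mem_epigraph)
  ultimately obtain a b where
    ab: "inner a (x, f x - \<eta>) < b" "\<forall>w\<in>epigraph UNIV f. b < inner a w"
    using separating_hyperplane_closed_point[OF convex_epigraphI[OF f]] by metis
  obtain p q where a: "a = (p, q)"
    by fastforce
  have above: "b < p \<bullet> z + q * f z" for z
    using ab(2)[rule_format, of "(z, f z)"] by (simp add: a mem_epigraph)
  have below: "p \<bullet> x + q * (f x - \<eta>) < b"
    using ab(1) by (simp add: a)
  have "q * \<eta> > 0"
    using above[of x] below by (simp add: algebra_simps)
  then have q: "q > 0"
    using \<open>\<eta> > 0\<close> by (simp add: zero_less_mult_iff)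
  have "(- p /\<^sub>R q) \<bullet> z + b / q \<le> f z" for z
    using above[of z] q by (simp add: field_simps)
  moreover have "f x - \<eta> < (- p /\<^sub>R q) \<bullet> x + b / q"
    using below q by (simp add: field_simps)
  ultimately show ?thesis
    by blast
qed

text \<open>
  Finitely many affine minorants suffice on a compact set: one that is good at a point is still good
  in a neighbourhood of it.
\<close>

lemma convex_on_finite_affine_minorants:
  fixes f :: "'a::euclidean_space \<Rightarrow> real"
  assumes f: "convex_on UNIV f" and "\<eta> > 0" and "compact S" and "S \<noteq> {}"
  obtains F where "finite F" "F \<noteq> {}" "\<And>p c z. (p, c) \<in> F \<Longrightarrow> p \<bullet> z + c \<le> f z"
    "\<And>x. x \<in> S \<Longrightarrow> \<exists>(p, c)\<in>F. f x - \<eta> < p \<bullet> x + c"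
proof -
  have cont: "continuous_on UNIV f"
    using convex_on_continuous[OF open_UNIV f] .
  define A where "A = {(p, c). \<forall>z. p \<bullet> z + c \<le> f z}"
  define U where "U = (\<lambda>(p, c). {x. f x - \<eta> < p \<bullet> x + c})"
  have "open (U a)" for a
    by (auto simp: U_def split: prod.split intro!: open_Collect_less continuous_intros cont)
  moreover have "S \<subseteq> (\<Union>a\<in>A. U a)"
    using convex_on_affine_minorant[OF f \<open>\<eta> > 0\<close>] by (fastforce simp: A_def U_def)
  ultimately obtain F where F: "F \<subseteq> A" "finite F" "S \<subseteq> (\<Union>a\<in>F. U a)"
    using compactE_image[OF \<open>compact S\<close>] by metis
  show ?thesis
  proof
    show "finite F" "F \<noteq> {}"
      using F \<open>S \<noteq> {}\<close> by auto
    show "p \<bullet> z + c \<le> f z" if "(p, c) \<in> F" for p c z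
      using that F by (auto simp: A_def)
    show "\<exists>(p, c)\<in>F. f x - \<eta> < p \<bullet> x + c" if "x \<in> S" for x
      using that F by (fastforce simp: U_def)
  qed
qed

text \<open>
  By convexity, a function vanishing at the centre of a sphere grows at least linearly along rays
  outside the sphere, with slope governed by its minimum there; compactness of the zero set provides
  a sphere on which this minimum is positive.
\<close>

lemma convex_on_linear_growth:
  fixes f :: "'a::euclidean_space \<Rightarrow> real"
  assumes nonneg: "\<And>x. 0 \<le> f x" and f: "convex_on UNIV f"
    and "{x. f x = 0} \<noteq> {}" and "compact {x. f x = 0}"
  obtains a b where "a > 0" "\<And>x. a * norm x - b \<le> f x"
proof -
  obtain x0 where x0: "f x0 = 0"
    using assms by auto
  have "bounded {x. f x = 0}"
    using assms compact_imp_bounded by blast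
  then obtain \<rho> where rho: "\<rho> > 0" "{x. f x = 0} \<subseteq> ball x0 \<rho>"
    using bounded_subset_ballD by blast
  have "continuous_on (sphere x0 \<rho>) f"
    using convex_on_continuous[OF open_UNIV f] continuous_on_subset by blast
  moreover have "sphere x0 \<rho> \<noteq> {}"
    using rho by simp
  ultimately obtain w where w: "w \<in> sphere x0 \<rho>" "\<And>y. y \<in> sphere x0 \<rho> \<Longrightarrow> f w \<le> f y"
    using continuous_attains_inf[OF compact_sphere] by metis
  define m where "m = f w"
  have "w \<notin> ball x0 \<rho>"
    using w(1) by auto
  then have "f w \<noteq> 0"
    using rho by blast
  then have m: "m > 0"
    using nonneg[of w] by (simp add: m_def)
  have growth: "m / \<rho> * norm (x - x0) - m \<le> f x" for x
  proof (cases "norm (x - x0) \<le> \<rho>")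
    case True
    then have "m / \<rho> * norm (x - x0) \<le> m"
      using m rho by (simp add: field_simps)
    then show ?thesis
      using nonneg[of x] by linarith
  next
    case False
    then have "norm (x - x0) > 0"
      using rho by linarith
    define t where "t = \<rho> / norm (x - x0)"
    have t: "0 < t" "t < 1"
      using False rho \<open>norm (x - x0) > 0\<close> by (simp_all add: t_def divide_less_eq)
    have "(1 - t) *\<^sub>R x0 + t *\<^sub>R x = x0 + t *\<^sub>R (x - x0)"
      by (simp add: algebra_simps)
    moreover have "x0 + t *\<^sub>R (x - x0) \<in> sphere x0 \<rho>"
      using False rho by (auto simp: t_def dist_norm)
    ultimately have "m \<le> t * f x"
      using w(2) convex_onD[OF f, of t x0 x] t x0 by (fastforce simp: m_def)
    then have "m / \<rho> * norm (x - x0) \<le> f x"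
      using \<open>norm (x - x0) > 0\<close> rho
      by (simp add: t_def pos_le_divide_eq pos_divide_le_eq mult.commute)
    then show ?thesis
      using m by simp
  qed
  have "m / \<rho> * norm x - (m / \<rho> * norm x0 + m) \<le> f x" for x
  proof -
    have "m / \<rho> * norm x \<le> m / \<rho> * (norm (x - x0) + norm x0)"
      using m rho norm_triangle_sub[of x x0] by (intro mult_left_mono) (auto simp: add.commute)
    then show ?thesis
      using growth[of x] by (simp add: algebra_simps)
  qed
  then show ?thesis
    using that[of "m / \<rho>"] m rho(1) by (meson divide_pos_pos)
qed

lemma continuous_bounded_on_cball:
  fixes f :: "'a::euclidean_space \<Rightarrow> real"
  assumes "continuous_on UNIV f"
  shows "\<exists>B>0. \<forall>x. norm x \<le> r \<longrightarrow> \<bar>f x\<bar> \<le> B"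
proof -
  have "compact (f ` cball 0 r)"
    by (rule compact_continuous_image[OF continuous_on_subset[OF assms]]) auto
  from compact_imp_bounded[OF this] show ?thesis
    by (auto simp: bounded_pos)
qed

section \<open>A tangential criterion for bounded convex exhaustion hulls\<close>

text \<open>
  If the tangent plane at \<open>x\<close> passes below \<open>K\<close>, then the half-space above it contains both the
  epigraph and \<open>K\<close>, hence their convex hull; so over \<open>x\<close> the hull adds nothing to the epigraph.
  When the tangent planes sink to \<open>-\<infinity>\<close> locally uniformly, this happens for all \<open>x\<close> outside a ball.
  Over that ball, the exhaustion hull lies below the graph and above any one of these planes.
\<close>

lemma BCEH_epigraph_if_tangents_sink:
  fixes f :: "'a::euclidean_space \<Rightarrow> real"
  assumes f: "convex_on UNIV f" and D: "\<And>x. (f has_derivative D x) (at x)"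
    and sink: "\<And>r. \<exists>M. \<forall>x k. M \<le> norm x \<longrightarrow> norm k \<le> r \<longrightarrow> f x + D x (k - x) \<le> - r"
  shows "BCEH (epigraph UNIV f)"
proof -
  let ?E = "epigraph UNIV f"
  have cont: "continuous_on UNIV f"
    using convex_on_continuous[OF open_UNIV f] .
  have "closed ?E"
    unfolding epigraph_def using cont
    by (auto intro!: closed_Collect_le continuous_intros continuous_on_compose2[OF cont])
  moreover have "bounded (exhaustion_hull ?E K)" if K: "compact K" for K
  proof -
    obtain r where r: "\<And>w. w \<in> K \<Longrightarrow> norm w \<le> r"
      using compact_imp_bounded[OF K] bounded_iff by metis
    obtain M0 where M0: "\<And>x k. M0 \<le> norm x \<Longrightarrow> norm k \<le> r \<Longrightarrow> f x + D x (k - x) \<le> - r"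
      using sink by metis
    define M where "M = max M0 0"
    define H where "H = (\<lambda>x. epigraph UNIV (\<lambda>z. f x + D x (z - x)))"
    have linD: "linear (D x)" for x
      using D has_derivative_linear by blast
    have hull: "convex hull (?E \<union> K) \<subseteq> H x" if x: "M \<le> norm x" for x
    proof (rule hull_minimal)
      have "convex_on UNIV (\<lambda>z. f x + D x (z - x))"
      proof (rule convex_onI)
        fix t :: real and a b
        have "(1 - t) *\<^sub>R a + t *\<^sub>R b - x = (1 - t) *\<^sub>R (a - x) + t *\<^sub>R (b - x)"
          by (simp add: algebra_simps)
        then have "D x ((1 - t) *\<^sub>R a + t *\<^sub>R b - x) = (1 - t) * D x (a - x) + t * D x (b - x)"
          using linD[of x] by (simp only: linear_add linear_scale real_scaleR_def)
        then show "f x + D x ((1 - t) *\<^sub>R a + t *\<^sub>R b - x)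
            \<le> (1 - t) * (f x + D x (a - x)) + t * (f x + D x (b - x))"
          by (simp add: algebra_simps)
      qed simp
      then show "convex (H x)"
        unfolding H_def by (rule convex_epigraphI)
      have "?E \<subseteq> H x"
        using convex_on_above_tangent[OF f D] by (auto simp: H_def epigraph_def intro: order_trans)
      moreover have "K \<subseteq> H x"
      proof
        fix w assume "w \<in> K"
        then have "norm (fst w) \<le> r" "\<bar>snd w\<bar> \<le> r"
          using r[of w] norm_fst_le[of "fst w" "snd w"] norm_snd_le[of "snd w" "fst w"] by auto
        then show "w \<in> H x"
          using M0[of x "fst w"] x by (auto simp: H_def epigraph_def M_def)
      qed
      ultimately show "?E \<union> K \<subseteq> H x"
        by simp
    qed
    obtain x1 :: 'a where x1: "norm x1 = M"
      using vector_choose_size[of M] by (auto simp: M_def)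
    obtain B where B: "\<And>x. norm x \<le> M \<Longrightarrow> \<bar>f x\<bar> \<le> B"
      using continuous_bounded_on_cball[OF cont] by blast
    have contD: "continuous_on UNIV (D x1)"
      by (rule linear_continuous_on[OF has_derivative_bounded_linear[OF D]])
    have "continuous_on UNIV (\<lambda>z. f x1 + D x1 (z - x1))"
      by (intro continuous_on_add continuous_on_const continuous_on_compose2[OF contD]
          continuous_on_diff continuous_on_id) auto
    then obtain C where C: "\<And>z. norm z \<le> M \<Longrightarrow> \<bar>f x1 + D x1 (z - x1)\<bar> \<le> C"
      using continuous_bounded_on_cball[of "\<lambda>z. f x1 + D x1 (z - x1)" M] by blast
    have "exhaustion_hull ?E K \<subseteq> cball 0 M \<times> {- C..B}"
    proof
      fix w assume w: "w \<in> exhaustion_hull ?E K"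
      obtain z y where wzy: "w = (z, y)"
        by fastforce
      have out: "y < f z"
        using w by (simp add: wzy exhaustion_hull_def mem_epigraph)
      have inH: "f x + D x (z - x) \<le> y" if "M \<le> norm x" for x
        using w hull[OF that] by (auto simp: wzy exhaustion_hull_def H_def epigraph_def)
      have z: "norm z \<le> M"
        using inH[of z] out linear_0[OF linD] by fastforce
      show "w \<in> cball 0 M \<times> {- C..B}"
        using z C[OF z] B[OF z] out inH[of x1] x1 by (auto simp: wzy)
    qed
    then show ?thesis
      using bounded_subset bounded_Times bounded_cball bounded_closed_interval by metis
  qed
  ultimately show ?thesis
    using convex_epigraphI[OF f] by (simp add: BCEH_def)
qed

section \<open>The smooth maximum of finitely many affine functions\<close>

definition smooth_max :: "real \<Rightarrow> ('a::euclidean_space \<times> real) set \<Rightarrow> 'a \<Rightarrow> real" where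
  "smooth_max t F x = ln (\<Sum>(p, c)\<in>F. exp (t * (p \<bullet> x + c))) / t"

lemma sum_exp_pos:
  assumes "finite F" "F \<noteq> {}"
  shows "(\<Sum>(p, c)\<in>F. exp (t * (p \<bullet> x + c))) > (0::real)"
  using assms by (intro sum_pos) auto

lemma exp_smooth_max:
  assumes "finite F" "F \<noteq> {}" "t > 0"
  shows "exp (t * smooth_max t F x) = (\<Sum>(p, c)\<in>F. exp (t * (p \<bullet> x + c)))"
  using sum_exp_pos[OF assms(1,2)] assms(3) by (simp add: smooth_max_def)

lemma smooth_max_ge:
  assumes "finite F" "(p, c) \<in> F" "t > 0"
  shows "p \<bullet> x + c \<le> smooth_max t F x"
proof -
  have "exp (t * (p \<bullet> x + c)) \<le> (\<Sum>(p, c)\<in>F. exp (t * (p \<bullet> x + c)))"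
    using member_le_sum[OF assms(2), of "\<lambda>(p, c). exp (t * (p \<bullet> x + c))"] assms by auto
  also have "\<dots> = exp (t * smooth_max t F x)"
    using exp_smooth_max[of F t x] assms by (metis empty_iff)
  finally show ?thesis
    using assms by simp
qed

lemma smooth_max_le:
  assumes F: "finite F" "F \<noteq> {}" and "t > 0" and m: "\<And>p c. (p, c) \<in> F \<Longrightarrow> p \<bullet> x + c \<le> m"
  shows "smooth_max t F x \<le> m + ln (card F) / t"
proof -
  have card: "real (card F) > 0"
    using F by (simp add: card_gt_0_iff)
  have "exp (t * smooth_max t F x) \<le> (\<Sum>a\<in>F. exp (t * m))"
    unfolding exp_smooth_max[OF F \<open>t > 0\<close>] using m \<open>t > 0\<close> by (intro sum_mono) auto
  also have "\<dots> = exp (t * m + ln (card F))"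
    using card by (simp add: exp_add)
  finally show ?thesis
    using \<open>t > 0\<close> by (simp add: field_simps)
qed

text \<open>
  Writing \<open>L\<close> for the smooth maximum, the inequality to prove says that the exponentials of
  \<open>t * (p \<bullet> z + c - (1 - u) * L x - u * L y)\<close>, \<open>z\<close> being the convex combination, have sum at most \<open>1\<close>.
  Each is at most the convex combination of \<open>exp (t * (p \<bullet> x + c - L x))\<close> and
  \<open>exp (t * (p \<bullet> y + c - L y))\<close>, and both of these sum to \<open>1\<close>.
\<close>

lemma convex_on_smooth_max:
  assumes F: "finite F" "F \<noteq> {}" and t: "t > 0"
  shows "convex_on UNIV (smooth_max t F)"
proof (rule convex_onI)
  fix u :: real and x y :: 'a
  assume u: "0 < u" "u < 1"
  define z where "z = (1 - u) *\<^sub>R x + u *\<^sub>R y"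
  let ?L = "smooth_max t F"
  define m where "m = (1 - u) * ?L x + u * ?L y"
  have one: "(\<Sum>(p, c)\<in>F. exp (t * (p \<bullet> w + c) - t * ?L w)) = 1" for w
  proof -
    have "(\<Sum>(p, c)\<in>F. exp (t * (p \<bullet> w + c) - t * ?L w))
        = (\<Sum>(p, c)\<in>F. exp (t * (p \<bullet> w + c))) / exp (t * ?L w)"
      by (simp add: exp_diff sum_divide_distrib case_prod_unfold)
    then show ?thesis
      using sum_exp_pos[OF F, of t w] by (simp add: exp_smooth_max[OF F t])
  qed
  have "exp (t * (p \<bullet> z + c) - t * m)
      \<le> (1 - u) * exp (t * (p \<bullet> x + c) - t * ?L x) + u * exp (t * (p \<bullet> y + c) - t * ?L y)" for p c
  proof -
    have "t * (p \<bullet> z + c) - t * m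
        = (1 - u) *\<^sub>R (t * (p \<bullet> x + c) - t * ?L x) + u *\<^sub>R (t * (p \<bullet> y + c) - t * ?L y)"
      by (simp add: z_def m_def inner_add_right algebra_simps)
    then show ?thesis
      using convex_onD[OF exp_convex, of u] u by simp
  qed
  then have "(\<Sum>(p, c)\<in>F. exp (t * (p \<bullet> z + c) - t * m))
      \<le> (\<Sum>(p, c)\<in>F. (1 - u) * exp (t * (p \<bullet> x + c) - t * ?L x) + u * exp (t * (p \<bullet> y + c) - t * ?L y))"
    by (intro sum_mono) auto
  also have "\<dots> = 1"
    using one[of x] one[of y]
    by (simp add: case_prod_unfold sum.distrib flip: sum_distrib_left)
  finally have "(\<Sum>(p, c)\<in>F. exp (t * (p \<bullet> z + c))) / exp (t * m) \<le> 1"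
    by (simp add: exp_diff sum_divide_distrib case_prod_unfold)
  then have "exp (t * ?L z) \<le> exp (t * m)"
    by (simp add: exp_smooth_max[OF F t])
  then show "?L ((1 - u) *\<^sub>R x + u *\<^sub>R y) \<le> (1 - u) * ?L x + u * ?L y"
    using t by (simp add: z_def m_def)
qed simp

lemma C_k_smooth_max:
  assumes F: "finite F" "F \<noteq> {}"
  shows "C_k k (smooth_max t F)"
proof -
  have "C_k k (\<lambda>x. exp (t * (p \<bullet> x + c)))" for p :: 'a and c
    by (intro C_k_exp C_k_mult C_k_add C_k_const C_k_bounded_linear bounded_linear_inner_right)
  then have "C_k k (\<lambda>x. \<Sum>(p, c)\<in>F. exp (t * (p \<bullet> x + c)))"
    by (auto simp: case_prod_unfold intro!: C_k_sum)
  then have "C_k k (\<lambda>x. ln (\<Sum>(p, c)\<in>F. exp (t * (p \<bullet> x + c))) * inverse t)"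
    by (intro C_k_mult C_k_ln C_k_const sum_exp_pos F)
  then show ?thesis
    by (simp add: smooth_max_def[abs_def] divide_inverse)
qed

section \<open>A smooth convex function of linear growth with sinking tangent planes\<close>

abbreviation bracket :: "'a::euclidean_space \<Rightarrow> real" where
  "bracket x \<equiv> sqrt (1 + x \<bullet> x)"

text \<open>
  The tangent planes of the bracket itself stay bounded at the origin, as for a cone. The correction
  by the logarithm is what makes them sink: as a function of \<open>s \<ge> 1\<close>, \<open>s - ln s\<close> is still convex and
  nondecreasing, but its tangent line at \<open>s\<close> has intercept \<open>1 - ln s\<close>.
\<close>

definition log_bent_norm :: "'a::euclidean_space \<Rightarrow> real" where
  "log_bent_norm x = bracket x - ln (bracket x)"

lemma bracket_ge_1: "1 \<le> bracket x"
  by simp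

lemma norm_le_bracket: "norm x \<le> bracket x"
  by (simp add: norm_eq_sqrt_inner)

lemma bracket_eq_norm: "bracket x = norm (1::real, x)"
  by (simp add: norm_Pair power2_norm_eq_inner)

lemma bracket_le: "bracket x \<le> 1 + norm x"
  using norm_triangle_ineq[of "(1::real, 0)" "(0, x)"] by (simp add: bracket_eq_norm norm_Pair)

lemma log_bent_norm_le: "log_bent_norm x \<le> 1 + norm x"
  using bracket_le[of x] ln_ge_zero[OF bracket_ge_1[of x]]
  unfolding log_bent_norm_def by linarith

text \<open>
  The bracket is convex, being the norm of an affine function, and \<open>s - ln s\<close> is convex and
  nondecreasing for \<open>s \<ge> 1\<close>; monotonicity is the inequality \<open>ln q \<le> q - 1\<close> for the quotient of two
  arguments.
\<close>

lemma convex_on_log_bent_norm: "convex_on UNIV log_bent_norm"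
proof (rule convex_onI)
  fix u :: real and x y :: 'a
  assume u: "0 < u" "u < 1"
  define z where "z = (1 - u) *\<^sub>R x + u *\<^sub>R y"
  define s where "s = (1 - u) * bracket x + u * bracket y"
  have "(1::real, z) = (1 - u) *\<^sub>R (1, x) + u *\<^sub>R (1, y)"
    by (simp add: z_def)
  then have zs: "bracket z \<le> s"
    using norm_triangle_ineq[of "(1 - u) *\<^sub>R (1::real, x)" "u *\<^sub>R (1, y)"] u
    by (simp only: bracket_eq_norm s_def norm_scaleR)
  have z1: "bracket z \<ge> 1"
    by (rule bracket_ge_1)
  have "s > 0" "bracket z > 0"
    using zs z1 by linarith+
  then have "ln s - ln (bracket z) = ln (s / bracket z)"
    by (simp only: ln_divide_pos)
  also have "\<dots> \<le> s / bracket z - 1"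
    using \<open>s > 0\<close> \<open>bracket z > 0\<close> by (intro ln_le_minus_one divide_pos_pos)
  also have "\<dots> = (s - bracket z) / bracket z"
    using \<open>bracket z > 0\<close> by (metis diff_divide_distrib divide_self less_irrefl)
  also have "\<dots> \<le> (s - bracket z) / 1"
    using zs z1 \<open>bracket z > 0\<close> by (intro divide_left_mono mult_pos_pos) linarith+
  finally have mono: "bracket z - ln (bracket z) \<le> s - ln s"
    by simp
  have "(1 - u) * ln (bracket x) + u * ln (bracket y) \<le> ln s"
    using concave_onD[OF ln_concave, of u "bracket x" "bracket y"] u bracket_ge_1[of x] bracket_ge_1[of y]
    by (simp add: s_def add_pos_nonneg)
  then have "log_bent_norm z \<le> (1 - u) * log_bent_norm x + u * log_bent_norm y"
    using mono unfolding log_bent_norm_def s_def right_diff_distrib by linarith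
  then show "log_bent_norm ((1 - u) *\<^sub>R x + u *\<^sub>R y)
      \<le> (1 - u) * log_bent_norm x + u * log_bent_norm y"
    by (simp only: z_def)
qed simp

lemma C_k_log_bent_norm: "C_k k (log_bent_norm :: 'a::euclidean_space \<Rightarrow> real)"
proof -
  have sq: "C_k k (\<lambda>x::'a. x \<bullet> x)" for k
  proof (cases k)
    case 0
    then show ?thesis
      by (auto intro!: continuous_intros)
  next
    case (Suc j)
    have "C_k (Suc j) (\<lambda>x::'a. x \<bullet> x)"
      by (rule C_k_SucI[of _ "\<lambda>x v. x \<bullet> v + v \<bullet> x"])
        (auto intro!: derivative_eq_intros C_k_add C_k_bounded_linear
          bounded_linear_add bounded_linear_inner_left bounded_linear_inner_right)
    then show ?thesis
      using Suc by simp
  qed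
  have pos: "1 + x \<bullet> x > 0" for x :: 'a
    by (simp add: add_pos_nonneg)
  then have "C_k k (bracket :: 'a \<Rightarrow> real)"
    by (intro C_k_sqrt C_k_add C_k_const sq)
  then have "C_k k (\<lambda>x::'a. bracket x + (-1) * ln (bracket x))"
    using pos by (intro C_k_add C_k_mult C_k_const C_k_ln) auto
  then show ?thesis
    by (simp add: log_bent_norm_def[abs_def])
qed

lemma log_bent_norm_has_derivative:
  "(log_bent_norm has_derivative (\<lambda>v. (1 - 1 / bracket x) * (x \<bullet> v) / bracket x)) (at x)"
proof -
  have pos: "1 + x \<bullet> x > 0"
    by (simp add: add_pos_nonneg)
  have s: "(bracket has_derivative (\<lambda>v. (x \<bullet> v) / bracket x)) (at x)"
    using pos by (auto intro!: derivative_eq_intros simp: inner_commute field_simps)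
  have "((\<lambda>x. bracket x - ln (bracket x)) has_derivative
      (\<lambda>v. (x \<bullet> v) / bracket x - (x \<bullet> v) / bracket x / bracket x)) (at x)"
  proof (rule has_derivative_diff[OF s])
    have "bracket x > 0"
      using pos by simp
    from has_derivative_ln[OF this s]
    show "((\<lambda>x. ln (bracket x)) has_derivative (\<lambda>v. (x \<bullet> v) / bracket x / bracket x)) (at x)"
      by (simp only: divide_inverse)
  qed
  moreover have "(x \<bullet> v) / bracket x - (x \<bullet> v) / bracket x / bracket x
      = (1 - 1 / bracket x) * (x \<bullet> v) / bracket x" for v
    by (simp only: left_diff_distrib diff_divide_distrib times_divide_eq_left mult_1_left)
  ultimately show ?thesis
    by (simp add: log_bent_norm_def[abs_def])
qed

text \<open>
  The left-hand side is the height at \<open>k\<close> of the tangent plane at \<open>x\<close>. The slope of the plane is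
  less than \<open>1\<close>, which accounts for \<open>norm k\<close>; the rest is its height at the origin.
\<close>

lemma log_bent_norm_tangent_le:
  "log_bent_norm x + (1 - 1 / bracket x) * (x \<bullet> (k - x)) / bracket x
    \<le> 2 + norm k - ln (bracket x)"
proof -
  define s where "s = bracket x"
  have s: "s \<ge> 1" and sq: "x \<bullet> x = s * s - 1"
    using bracket_ge_1[of x] by (simp_all add: s_def add_nonneg_nonneg)
  have "x \<bullet> k \<le> norm x * norm k"
    by (rule norm_cauchy_schwarz)
  also have "\<dots> \<le> s * norm k"
    unfolding s_def by (intro mult_right_mono norm_le_bracket) auto
  finally have "(x \<bullet> k) / s \<le> norm k"
    using s by (simp add: field_simps)
  then have "(1 - 1 / s) * ((x \<bullet> k) / s) \<le> (1 - 1 / s) * norm k"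
    using s by (intro mult_left_mono) auto
  also have "\<dots> \<le> 1 * norm k"
    using s by (intro mult_right_mono) auto
  finally have k: "(1 - 1 / s) * ((x \<bullet> k) / s) \<le> norm k"
    by simp
  have "(1 - 1 / s) * ((x \<bullet> x) / s) = s - 1 - 1 / s + 1 / s * (1 / s)"
    using s by (simp add: sq field_simps)
  moreover have "1 / s \<le> 1" "0 \<le> 1 / s * (1 / s)"
    using s by auto
  ultimately have "s - 2 \<le> (1 - 1 / s) * ((x \<bullet> x) / s)"
    by linarith
  moreover have "(1 - 1 / s) * (x \<bullet> (k - x)) / s
      = (1 - 1 / s) * ((x \<bullet> k) / s) - (1 - 1 / s) * ((x \<bullet> x) / s)"
    by (simp add: inner_diff_right diff_divide_distrib right_diff_distrib)
  ultimately show ?thesis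
    using k by (simp add: log_bent_norm_def flip: s_def)
qed

section \<open>Bending a convex function slightly\<close>

text \<open>
  By convexity the tangent planes of \<open>f\<close> stay below \<open>f\<close>, so they are bounded above on bounded sets,
  uniformly in the point of tangency. Adding any positive multiple of the bent norm therefore makes
  the tangent planes sink.
\<close>

lemma BCEH_epigraph_add_log_bent_norm:
  fixes f :: "'a::euclidean_space \<Rightarrow> real"
  assumes f: "convex_on UNIV f" and D: "\<And>x. (f has_derivative D x) (at x)" and "a > 0"
  shows "BCEH (epigraph UNIV (\<lambda>x. f x + a * log_bent_norm x))"
proof (rule BCEH_epigraph_if_tangents_sink)
  let ?D = "\<lambda>x v. (1 - 1 / bracket x) * (x \<bullet> v) / bracket x"
  show "convex_on UNIV (\<lambda>x. f x + a * log_bent_norm x)"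
    using \<open>a > 0\<close> by (intro convex_on_add convex_on_cmul f convex_on_log_bent_norm) auto
  show "((\<lambda>x. f x + a * log_bent_norm x) has_derivative (\<lambda>v. D x v + a * ?D x v)) (at x)" for x
    by (intro has_derivative_add D has_derivative_mult_right log_bent_norm_has_derivative)
  fix r :: real
  obtain B where "\<And>k. norm k \<le> r \<Longrightarrow> \<bar>f k\<bar> \<le> B"
    using continuous_bounded_on_cball[OF convex_on_continuous[OF open_UNIV f]] by blast
  then have B: "\<And>k. norm k \<le> r \<Longrightarrow> f k \<le> B"
    using abs_le_D1 by blast
  define c where "c = 2 + r + (B + r) / a"
  have "f x + a * log_bent_norm x + (D x (k - x) + a * ?D x (k - x)) \<le> - r"
    if x: "exp c \<le> norm x" and k: "norm k \<le> r" for x k :: 'a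
  proof -
    have "exp c \<le> bracket x"
      using x norm_le_bracket[of x] by linarith
    then have "c \<le> ln (bracket x)"
      by (subst ln_ge_iff) (use bracket_ge_1[of x] in linarith)
    then have "log_bent_norm x + ?D x (k - x) \<le> 2 + r - c"
      using log_bent_norm_tangent_le[of x k] k by linarith
    then have "a * (log_bent_norm x + ?D x (k - x)) \<le> a * (2 + r - c)"
      using \<open>a > 0\<close> by (intro mult_left_mono) auto
    also have "\<dots> = - B - r"
      using \<open>a > 0\<close> by (simp add: c_def field_simps)
    finally show ?thesis
      using convex_on_above_tangent[OF f D, of x k] B[OF k] by (simp add: distrib_left)
  qed
  then show "\<exists>M. \<forall>x k. M \<le> norm x \<longrightarrow> norm k \<le> r \<longrightarrow>
      f x + a * log_bent_norm x + (D x (k - x) + a * ?D x (k - x)) \<le> - r"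
    by blast
qed

section \<open>Approximation by smooth functions with bounded convex exhaustion hulls\<close>

theorem proposition3p11:
  fixes \<phi> :: "real ^ 'n \<Rightarrow> real" and \<epsilon> R :: real
  assumes "\<And>x. 0 \<le> \<phi> x"
    and "convex_on UNIV \<phi>"
    and "{x. \<phi> x = 0} \<noteq> {}"
    and "compact {x. \<phi> x = 0}"
    and "\<epsilon> > 0" and "R > 0"
  shows "\<exists>\<psi> :: real ^ 'n \<Rightarrow> real.
    smooth \<psi> \<and> convex_on UNIV \<psi> \<and>
    (\<forall>x. \<psi> x < \<phi> x) \<and>
    (\<forall>x. norm x \<le> R \<longrightarrow> \<phi> x - \<psi> x < \<epsilon>) \<and>
    BCEH (epigraph UNIV \<psi>)"
proof -
  note \<phi> = assms(2)
  obtain a b where a: "a > 0" and ab: "\<And>x. a * norm x - b \<le> \<phi> x"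
    using convex_on_linear_growth[OF assms(1-4)] by metis
  \<comment> \<open>The summand \<open>a\<close> of the constant absorbs the bound \<open>log_bent_norm x \<le> 1 + norm x\<close>, and the
    summand \<open>1\<close> makes the inequality strict.\<close>
  define h where "h = (\<lambda>x::real ^ 'n. a * log_bent_norm x - (a + b + 1))"
  have h: "h x < \<phi> x" for x
    using ab[of x] mult_left_mono[OF log_bent_norm_le[of x], of a] a
    by (simp add: h_def algebra_simps)

  have "cball 0 R \<noteq> ({} :: (real ^ 'n) set)"
    using \<open>R > 0\<close> by simp
  then obtain F where F: "finite F" "F \<noteq> {}"
    and below: "\<And>p c z. (p, c) \<in> F \<Longrightarrow> p \<bullet> z + c \<le> \<phi> z"
    and near: "\<And>x. x \<in> cball 0 R \<Longrightarrow> \<exists>(p, c)\<in>F. \<phi> x - \<epsilon> / 4 < p \<bullet> x + c"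
    using convex_on_finite_affine_minorants[OF \<phi> _ compact_cball, of "\<epsilon> / 4" 0 R] \<open>\<epsilon> > 0\<close>
    by (metis zero_less_divide_iff zero_less_numeral)
  \<comment> \<open>With this parameter the smooth maximum exceeds the maximum by less than \<open>\<epsilon> / 4\<close>; the summand \<open>1\<close>
    keeps it positive when there is only one affine function.\<close>
  define t where "t = 4 * (ln (card F) + 1) / \<epsilon>"
  have "card F \<ge> 1"
    using F by (simp add: Suc_leI card_gt_0_iff)
  then have lnF: "ln (card F) \<ge> 0"
    by simp
  then have t: "t > 0" "ln (card F) / t < \<epsilon> / 4"
    using \<open>\<epsilon> > 0\<close> by (simp_all add: t_def field_simps)
  \<comment> \<open>The shift outweighs the excess of the smooth maximum. On the ball, the error of the affine
    minorants and the shift add up to at most \<open>3 / 4 * \<epsilon>\<close>, leaving \<open>\<epsilon> / 4\<close> for the share of \<open>h\<close>.\<close>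
  define L where "L = (\<lambda>x. smooth_max t F x - \<epsilon> / 2)"
  have L_less: "L x < \<phi> x" for x
    using smooth_max_le[OF F t(1) below, of x] t(2) \<open>\<epsilon> > 0\<close> unfolding L_def by linarith
  have L_near: "\<phi> x - L x < 3 / 4 * \<epsilon>" if x: "norm x \<le> R" for x
  proof -
    obtain p c where "(p, c) \<in> F" "\<phi> x - \<epsilon> / 4 < p \<bullet> x + c"
      using near[of x] x by auto
    then show ?thesis
      using smooth_max_ge[OF F(1) _ t(1), of p c x] by (simp add: L_def)
  qed

  have "continuous_on UNIV (log_bent_norm :: real ^ 'n \<Rightarrow> real)"
    using C_k_log_bent_norm[of 0] by simp
  then have "continuous_on UNIV h"
    unfolding h_def by (intro continuous_on_diff continuous_on_mult continuous_on_const)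
  then have "continuous_on UNIV (\<lambda>x. \<phi> x - h x)"
    by (intro continuous_on_diff convex_on_continuous[OF open_UNIV \<phi>])
  then obtain M where M: "M > 0" "\<And>x. norm x \<le> R \<Longrightarrow> \<bar>\<phi> x - h x\<bar> \<le> M"
    using continuous_bounded_on_cball[of "\<lambda>x. \<phi> x - h x" R] by blast
  define \<delta> where "\<delta> = \<epsilon> / 4 / (M + \<epsilon>)"
  have \<delta>: "0 < \<delta>" "\<delta> < 1" "\<delta> * M < \<epsilon> / 4"
  proof -
    show "0 < \<delta>" "\<delta> < 1"
      using M(1) \<open>\<epsilon> > 0\<close> by (simp_all add: \<delta>_def)
    have "M + \<epsilon> \<noteq> 0"
      using M(1) \<open>\<epsilon> > 0\<close> by linarith
    then have "\<delta> * (M + \<epsilon>) = \<epsilon> / 4"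
      using nonzero_eq_divide_eq[of "M + \<epsilon>" \<delta> "\<epsilon> / 4"] \<delta>_def by blast
    moreover have "0 < \<delta> * \<epsilon>"
      using \<open>0 < \<delta>\<close> \<open>\<epsilon> > 0\<close> by simp
    ultimately show "\<delta> * M < \<epsilon> / 4"
      unfolding distrib_left by linarith
  qed

  \<comment> \<open>The constant part of \<open>h\<close> is moved to the first summand, so that \<open>\<psi>\<close> has the form of
    \<open>BCEH_epigraph_add_log_bent_norm\<close>.\<close>
  define f where "f = (\<lambda>x. (1 - \<delta>) * L x + \<delta> * - (a + b + 1))"
  define \<psi> where "\<psi> = (\<lambda>x. f x + \<delta> * a * log_bent_norm x)"
  have \<psi>: "\<psi> x = (1 - \<delta>) * L x + \<delta> * h x" for x
    by (simp add: \<psi>_def f_def h_def algebra_simps)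
  have "C_k k (\<lambda>x. (1 - \<delta>) * (smooth_max t F x + - (\<epsilon> / 2)) + \<delta> * - (a + b + 1))" for k
    by (intro C_k_add C_k_mult C_k_const C_k_smooth_max F)
  then have C_k_f: "C_k k f" for k
    by (simp add: f_def L_def)
  have "convex_on UNIV (\<lambda>x. (1 - \<delta>) * (smooth_max t F x + - (\<epsilon> / 2)) + \<delta> * - (a + b + 1))"
    using \<delta> by (intro convex_on_add convex_on_cmul convex_on_smooth_max F t)
      (auto simp: convex_on_const)
  then have convex_f: "convex_on UNIV f"
    by (simp add: f_def L_def)
  have gap: "\<phi> x - \<psi> x = (1 - \<delta>) * (\<phi> x - L x) + \<delta> * (\<phi> x - h x)" for x
    by (simp add: \<psi> algebra_simps)

  show ?thesis
  proof (intro exI[of _ \<psi>] conjI allI impI)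
    show "smooth \<psi>"
      unfolding smooth_def \<psi>_def
      by (intro allI C_k_add C_k_mult C_k_const C_k_f C_k_log_bent_norm)
    show "convex_on UNIV \<psi>"
      unfolding \<psi>_def using \<delta> a
      by (intro convex_on_add convex_on_cmul convex_f convex_on_log_bent_norm) simp
    show "\<psi> x < \<phi> x" for x
    proof -
      have "0 < (1 - \<delta>) * (\<phi> x - L x) + \<delta> * (\<phi> x - h x)"
        using \<delta> L_less[of x] h[of x] by (intro add_pos_pos mult_pos_pos) linarith+
      then show ?thesis
        using gap[of x] by linarith
    qed
    show "\<phi> x - \<psi> x < \<epsilon>" if x: "norm x \<le> R" for x
    proof -
      have "(1 - \<delta>) * (\<phi> x - L x) \<le> 1 * (\<phi> x - L x)"
        using \<delta> L_less[of x] by (intro mult_right_mono) linarith+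
      moreover have "\<delta> * (\<phi> x - h x) \<le> \<delta> * M"
        using \<delta> M(2)[OF x] by (intro mult_left_mono) linarith+
      ultimately have "\<phi> x - \<psi> x \<le> 1 * (\<phi> x - L x) + \<delta> * M"
        unfolding gap by (rule add_mono)
      also have "\<dots> < \<epsilon>"
        using L_near[OF x] \<delta>(3) by simp
      finally show ?thesis .
    qed
    show "BCEH (epigraph UNIV \<psi>)"
      unfolding \<psi>_def using \<delta> a
      by (intro BCEH_epigraph_add_log_bent_norm[OF convex_f C_k_SucD(1)[OF C_k_f]]) simp
  qed
qed

end
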